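(* Let $\Gamma \subset \mathcal{H}_K^*$ be totally bounded (with respect to the dual norm $\|\cdot\|_K$), and let $(\Lambda_n)_{n\in\mathbb{N}}$ be chosen via the geometric greedy algorithm, i.e. $\Lambda_1=\{\lambda_1\}$ with $\lambda_1\in\Gamma$ and, for all $n\in\mathbb{N}$, $\Lambda_{n+1}=\Lambda_n\cup\{\lambda_{n+1}\}$, where $\lambda_{n+1}\in\Gamma$ satisfies $$\min_{\mu\in\Lambda_n}\|\lambda_{n+1}-\mu\|_K = \sup_{\lambda\in\Gamma}\min_{\mu\in\Lambda_n}\|\lambda-\mu\|_K = h_{\Lambda_n,\Gamma}.$$ Then $h_{\Lambda_n,\Gamma}\xrightarrow{n\to\infty}0$ and $$\| f - I_{K,\Lambda_n}(f) \|_{K} \xrightarrow{n \to \infty} 0 \qquad \text{for all } f \in \mathcal{H}_{K,\Gamma}.$$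
   Context: $K : \mathbb{R}^d \times \mathbb{R}^d \to \mathbb{R}$ is a positive definite function: $K$ is symmetric and for every finite set $\{x_1,\dots,x_n\}\subset\mathbb{R}^d$ of pairwise distinct points the matrix $(K(x_i,x_j))_{1\le i,j\le n}$ is symmetric positive definite. $\mathcal{H}_K$ is the reproducing kernel Hilbert space of real-valued functions on $\mathbb{R}^d$ generated by $K$, with norm $\|\cdot\|_K$; $\mathcal{H}_K^*$ is its (continuous) dual space, whose dual norm is also denoted $\|\cdot\|_K$. For $\lambda \in \mathcal{H}_K^*$, $\lambda^y K(\cdot,y)$ denotes the function $x \mapsto \lambda^y K(x,y)$ ($\lambda$ applied to $K(x,\cdot)$ as a function of $y$); it belongs to $\mathcal{H}_K$ and is the Riesz representer of $\lambda$, i.e. $\lambda(f) = \langle f, \lambda^y K(\cdot,y)\rangle_{\mathcal{H}_K}$ for all $f \in \mathcal{H}_K$. For a finite set $\Lambda = \{\lambda_1,\dots,\lambda_n\}\subset\mathcal{H}_K^*$, let $\mathcal{S}_{K,\Lambda} = \mathrm{span}\{\lambda_1^yK(\cdot,y),\dots,\lambda_n^yK(\cdot,y)\}$. For $f\in\mathcal{H}_K$, $I_{K,\Lambda}(f)$ is the unique $s\in\mathcal{S}_{K,\Lambda}$ with $\lambda_i(s)=\lambda_i(f)$ for all $i$; equivalently, $I_{K,\Lambda}$ is the orthogonal projection of $\mathcal{H}_K$ onto $\mathcal{S}_{K,\Lambda}$ (if the functionals are linearly dependent, redundant ones may be removed without changing $\mathcal{S}_{K,\Lambda}$ or the projection).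 For $\Gamma\subset\mathcal{H}_K^*$, $\mathcal{H}_{K,\Gamma}$ is the closure in $\mathcal{H}_K$ of $\mathrm{span}\{\lambda^yK(\cdot,y) \mid \lambda\in\Gamma\}$. The generalized fill distance of a finite (nonempty) set $\Lambda\subset\Gamma$ in $\Gamma$ is $h_{\Lambda,\Gamma} = \sup_{\gamma\in\Gamma}\min_{\lambda\in\Lambda}\|\gamma-\lambda\|_K$. *)

theory Defs
  imports "HOL-Analysis.Analysis" "HOL-Library.Function_Algebras"
begin

text \<open>The pointwise vector space structure on functions, which makes the library constants
  \<^const>\<open>subspace\<close> and \<^const>\<open>span\<close> available for spaces of real-valued functions.\<close>

instantiation "fun" :: (type, real_vector) real_vector
begin

definition scaleR_fun :: "real \<Rightarrow> ('a \<Rightarrow> 'b) \<Rightarrow> 'a \<Rightarrow> 'b"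
  where "scaleR_fun c f = (\<lambda>x. c *\<^sub>R f x)"

instance
  by standard (auto simp: scaleR_fun_def fun_eq_iff scaleR_add_right scaleR_add_left)

end

definition positive_definite_kernel :: "('x \<Rightarrow> 'x \<Rightarrow> real) \<Rightarrow> bool"
  where "positive_definite_kernel K \<longleftrightarrow>
    (\<forall>x y. K x y = K y x) \<and>
    (\<forall>X c. finite X \<longrightarrow> (\<exists>x\<in>X. c x \<noteq> 0) \<longrightarrow> 0 < (\<Sum>x\<in>X. \<Sum>y\<in>X. c x * K x y * c y))"

text \<open>A Hilbert space of functions is a set \<open>H\<close> of functions with an inner product \<open>ip\<close>, of which
  only the values on \<open>H\<close> matter.\<close>

definition inner_product_on :: "('x \<Rightarrow> real) set \<Rightarrow> (('x \<Rightarrow> real) \<Rightarrow> ('x \<Rightarrow> real) \<Rightarrow> real) \<Rightarrow> bool"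
  where "inner_product_on H ip \<longleftrightarrow>
    (\<forall>f\<in>H. \<forall>g\<in>H. ip f g = ip g f) \<and>
    (\<forall>f\<in>H. \<forall>g\<in>H. \<forall>h\<in>H. ip (f + g) h = ip f h + ip g h) \<and>
    (\<forall>c. \<forall>f\<in>H. \<forall>g\<in>H. ip (c *\<^sub>R f) g = c * ip f g) \<and>
    (\<forall>f\<in>H. 0 \<le> ip f f) \<and>
    (\<forall>f\<in>H. ip f f = 0 \<longrightarrow> f = 0)"

definition fnorm :: "(('x \<Rightarrow> real) \<Rightarrow> ('x \<Rightarrow> real) \<Rightarrow> real) \<Rightarrow> ('x \<Rightarrow> real) \<Rightarrow> real"
  where "fnorm ip f = sqrt (ip f f)"

text \<open>The locale \<^locale>\<open>Metric_space\<close> asks for nonnegativity and symmetry on the whole type; therefore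
  distances are set to \<open>0\<close> outside the carrier, here and in \<open>dual_dist\<close> below.\<close>

definition fdist ::
  "('x \<Rightarrow> real) set \<Rightarrow> (('x \<Rightarrow> real) \<Rightarrow> ('x \<Rightarrow> real) \<Rightarrow> real) \<Rightarrow> ('x \<Rightarrow> real) \<Rightarrow> ('x \<Rightarrow> real) \<Rightarrow> real"
  where "fdist H ip f g = (if f \<in> H \<and> g \<in> H then fnorm ip (f - g) else 0)"

definition ftopology ::
  "('x \<Rightarrow> real) set \<Rightarrow> (('x \<Rightarrow> real) \<Rightarrow> ('x \<Rightarrow> real) \<Rightarrow> real) \<Rightarrow> ('x \<Rightarrow> real) topology"
  where "ftopology H ip = Metric_space.mtopology H (fdist H ip)"

text \<open>\<open>(H, ip)\<close> is the reproducing kernel Hilbert space generated by \<open>K\<close>. By the Moore--Aronszajn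
  theorem, the set \<open>H\<close> and the values of \<open>ip\<close> on \<open>H\<close> exist and are uniquely determined by \<open>K\<close>.\<close>

definition is_rkhs ::
  "('x \<Rightarrow> 'x \<Rightarrow> real) \<Rightarrow> ('x \<Rightarrow> real) set \<Rightarrow> (('x \<Rightarrow> real) \<Rightarrow> ('x \<Rightarrow> real) \<Rightarrow> real) \<Rightarrow> bool"
  where "is_rkhs K H ip \<longleftrightarrow>
    subspace H \<and> inner_product_on H ip \<and> Metric_space.mcomplete H (fdist H ip) \<and>
    (\<forall>x. (\<lambda>y. K y x) \<in> H) \<and>
    (\<forall>f\<in>H. \<forall>x. f x = ip f (\<lambda>y. K y x))"

text \<open>The continuous dual space of \<open>H\<close>. A functional on \<open>H\<close> is represented by a function on the whole
  type that is \<^const>\<open>undefined\<close> outside \<open>H\<close>, so that equality of functionals is equality on \<open>H\<close>.\<close>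

definition dual_space ::
  "('x \<Rightarrow> real) set \<Rightarrow> (('x \<Rightarrow> real) \<Rightarrow> ('x \<Rightarrow> real) \<Rightarrow> real) \<Rightarrow> (('x \<Rightarrow> real) \<Rightarrow> real) set"
  where "dual_space H ip = {\<phi> \<in> extensional H.
    (\<forall>f\<in>H. \<forall>g\<in>H. \<phi> (f + g) = \<phi> f + \<phi> g) \<and>
    (\<forall>c. \<forall>f\<in>H. \<phi> (c *\<^sub>R f) = c * \<phi> f) \<and>
    continuous_map (ftopology H ip) euclideanreal \<phi>}"

definition dual_norm ::
  "('x \<Rightarrow> real) set \<Rightarrow> (('x \<Rightarrow> real) \<Rightarrow> ('x \<Rightarrow> real) \<Rightarrow> real) \<Rightarrow> (('x \<Rightarrow> real) \<Rightarrow> real) \<Rightarrow> real"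
  where "dual_norm H ip \<phi> = (SUP f \<in> {f \<in> H. fnorm ip f \<le> 1}. \<bar>\<phi> f\<bar>)"

definition dual_dist ::
  "('x \<Rightarrow> real) set \<Rightarrow> (('x \<Rightarrow> real) \<Rightarrow> ('x \<Rightarrow> real) \<Rightarrow> real) \<Rightarrow>
   (('x \<Rightarrow> real) \<Rightarrow> real) \<Rightarrow> (('x \<Rightarrow> real) \<Rightarrow> real) \<Rightarrow> real"
  where "dual_dist H ip \<phi> \<psi> =
    (if \<phi> \<in> dual_space H ip \<and> \<psi> \<in> dual_space H ip then dual_norm H ip (\<phi> - \<psi>) else 0)"

definition dual_totally_bounded ::
  "('x \<Rightarrow> real) set \<Rightarrow> (('x \<Rightarrow> real) \<Rightarrow> ('x \<Rightarrow> real) \<Rightarrow> real) \<Rightarrow> (('x \<Rightarrow> real) \<Rightarrow> real) set \<Rightarrow> bool"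
  where "dual_totally_bounded H ip \<Gamma> \<longleftrightarrow>
    Metric_space.mtotally_bounded (dual_space H ip) (dual_dist H ip) \<Gamma>"

text \<open>The function \<open>\<phi>\<^sup>y K(\<cdot>, y)\<close>.\<close>

definition kernel_rep :: "('x \<Rightarrow> 'x \<Rightarrow> real) \<Rightarrow> (('x \<Rightarrow> real) \<Rightarrow> real) \<Rightarrow> 'x \<Rightarrow> real"
  where "kernel_rep K \<phi> = (\<lambda>x. \<phi> (\<lambda>y. K x y))"

definition trial_space :: "('x \<Rightarrow> 'x \<Rightarrow> real) \<Rightarrow> (('x \<Rightarrow> real) \<Rightarrow> real) set \<Rightarrow> ('x \<Rightarrow> real) set"
  where "trial_space K \<Lambda> = span (kernel_rep K ` \<Lambda>)"

definition interpolant ::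
  "('x \<Rightarrow> 'x \<Rightarrow> real) \<Rightarrow> (('x \<Rightarrow> real) \<Rightarrow> real) set \<Rightarrow> ('x \<Rightarrow> real) \<Rightarrow> 'x \<Rightarrow> real"
  where "interpolant K \<Lambda> f = (THE s. s \<in> trial_space K \<Lambda> \<and> (\<forall>\<phi>\<in>\<Lambda>. \<phi> s = \<phi> f))"

definition native_subspace ::
  "('x \<Rightarrow> 'x \<Rightarrow> real) \<Rightarrow> ('x \<Rightarrow> real) set \<Rightarrow> (('x \<Rightarrow> real) \<Rightarrow> ('x \<Rightarrow> real) \<Rightarrow> real) \<Rightarrow>
   (('x \<Rightarrow> real) \<Rightarrow> real) set \<Rightarrow> ('x \<Rightarrow> real) set"
  where "native_subspace K H ip \<Gamma> = ftopology H ip closure_of span (kernel_rep K ` \<Gamma>)"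

definition min_dist ::
  "('x \<Rightarrow> real) set \<Rightarrow> (('x \<Rightarrow> real) \<Rightarrow> ('x \<Rightarrow> real) \<Rightarrow> real) \<Rightarrow>
   (('x \<Rightarrow> real) \<Rightarrow> real) \<Rightarrow> (('x \<Rightarrow> real) \<Rightarrow> real) set \<Rightarrow> real"
  where "min_dist H ip \<phi> \<Lambda> = Min ((\<lambda>\<mu>. dual_dist H ip \<phi> \<mu>) ` \<Lambda>)"

text \<open>The supremum is taken in the reals; it is meaningful for bounded \<open>\<Gamma>\<close> and finite nonempty
  \<open>\<Lambda> \<subseteq> \<Gamma>\<close>.\<close>

definition fill_distance ::
  "('x \<Rightarrow> real) set \<Rightarrow> (('x \<Rightarrow> real) \<Rightarrow> ('x \<Rightarrow> real) \<Rightarrow> real) \<Rightarrow>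
   (('x \<Rightarrow> real) \<Rightarrow> real) set \<Rightarrow> (('x \<Rightarrow> real) \<Rightarrow> real) set \<Rightarrow> real"
  where "fill_distance H ip \<Lambda> \<Gamma> = (SUP \<gamma>\<in>\<Gamma>. min_dist H ip \<gamma> \<Lambda>)"

text \<open>Indices start at \<open>1\<close>; \<open>\<Lambda> 0\<close> and \<open>l 0\<close> are unconstrained.\<close>

definition geometric_greedy ::
  "('x \<Rightarrow> real) set \<Rightarrow> (('x \<Rightarrow> real) \<Rightarrow> ('x \<Rightarrow> real) \<Rightarrow> real) \<Rightarrow> (('x \<Rightarrow> real) \<Rightarrow> real) set \<Rightarrow>
   (nat \<Rightarrow> ('x \<Rightarrow> real) \<Rightarrow> real) \<Rightarrow> (nat \<Rightarrow> (('x \<Rightarrow> real) \<Rightarrow> real) set) \<Rightarrow> bool"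
  where "geometric_greedy H ip \<Gamma> l \<Lambda> \<longleftrightarrow>
    l 1 \<in> \<Gamma> \<and> \<Lambda> 1 = {l 1} \<and>
    (\<forall>n\<ge>1. \<Lambda> (Suc n) = \<Lambda> n \<union> {l (Suc n)} \<and> l (Suc n) \<in> \<Gamma> \<and>
      min_dist H ip (l (Suc n)) (\<Lambda> n) = fill_distance H ip (\<Lambda> n) \<Gamma>)"

end

theory Submission
  imports Defs
begin

text \<open>
  There are two independent ideas.

  \<^emph>\<open>The fill distances.\<close> Each functional picked by the greedy rule is at distance at least
  \<open>h\<^sub>n\<close>, the current fill distance, from all functionals picked before it, and the fill distances
  decrease because the sets grow. So if they stayed above some \<open>\<epsilon> > 0\<close>, the picked functionals would
  form an infinite \<open>\<epsilon>\<close>-separated sequence in \<open>\<Gamma>\<close>, which total boundedness excludes. In the form used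
  below, total boundedness provides a Cauchy subsequence of the picked functionals, and two of its
  late members bound a fill distance (\<open>fill_distance_greedy_tendsto_zero\<close>).

  \<^emph>\<open>The interpolants.\<close> By the Riesz representation theorem and the reproducing property,
  \<open>\<phi> \<mapsto> kernel_rep K \<phi>\<close> is an isometry from the dual space into \<open>H\<close> and
  \<open>\<phi> f = \<langle>f, kernel_rep K \<phi>\<rangle>\<close> (\<open>kernel_rep_represents\<close>, \<open>dual_dist_eq\<close>). Interpolation conditions are
  therefore orthogonality conditions: the interpolant is the orthogonal projection onto the trial
  space and hence the best approximation from it (\<open>interpolant_best_approximation\<close>). For \<open>\<gamma> \<in> \<Gamma>\<close> the
  error at \<open>kernel_rep K \<gamma>\<close> is then at most the distance from \<open>\<gamma>\<close> to \<open>\<Lambda>\<^sub>n\<close>, which the fill distance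
  controls. The functions whose errors tend to \<open>0\<close> form a closed linear subspace, so they include
  the closed span of all these representers (\<open>interpolant_tendsto_of_fill_distance\<close>).

  The inner product lives on a set of functions that varies, not on a type, so the elementary
  Hilbert space theory is developed in locales whose carrier is the set \<open>H\<close>.
\<close>

section \<open>Inner products on spaces of functions\<close>

locale inner_product_function_space =
  fixes H :: "('x \<Rightarrow> real) set" and ip :: "('x \<Rightarrow> real) \<Rightarrow> ('x \<Rightarrow> real) \<Rightarrow> real"
  assumes subspace_H: "subspace H" and inner_product: "inner_product_on H ip"
begin

abbreviation "nrm \<equiv> fnorm ip"

lemma zero_mem: "0 \<in> H"
  and add_mem: "f \<in> H \<Longrightarrow> g \<in> H \<Longrightarrow> f + g \<in> H"
  and diff_mem: "f \<in> H \<Longrightarrow> g \<in> H \<Longrightarrow> f - g \<in> H"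
  and scale_mem: "f \<in> H \<Longrightarrow> c *\<^sub>R f \<in> H"
  using subspace_H by (auto intro: subspace_0 subspace_add subspace_diff subspace_scale)

lemmas mem = zero_mem add_mem diff_mem scale_mem

lemma span_mem: "B \<subseteq> H \<Longrightarrow> f \<in> span B \<Longrightarrow> f \<in> H"
  using span_minimal[OF _ subspace_H] by blast

lemma ip_commute: "f \<in> H \<Longrightarrow> g \<in> H \<Longrightarrow> ip f g = ip g f"
  and ip_add_left: "f \<in> H \<Longrightarrow> g \<in> H \<Longrightarrow> h \<in> H \<Longrightarrow> ip (f + g) h = ip f h + ip g h"
  and ip_scale_left: "f \<in> H \<Longrightarrow> g \<in> H \<Longrightarrow> ip (c *\<^sub>R f) g = c * ip f g"
  and ip_nonneg: "f \<in> H \<Longrightarrow> 0 \<le> ip f f"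
  and ip_eq_zeroD: "f \<in> H \<Longrightarrow> ip f f = 0 \<Longrightarrow> f = 0"
  using inner_product by (simp_all add: inner_product_on_def)

lemma ip_zero_left: "f \<in> H \<Longrightarrow> ip 0 f = 0"
  using ip_scale_left[of 0 f 0] zero_mem by simp

lemma ip_diff_left: "f \<in> H \<Longrightarrow> g \<in> H \<Longrightarrow> h \<in> H \<Longrightarrow> ip (f - g) h = ip f h - ip g h"
  using ip_add_left[of "f - g" g h] by (simp add: mem)

lemma ip_zero_right: "f \<in> H \<Longrightarrow> ip f 0 = 0"
  using ip_zero_left ip_commute zero_mem by metis

lemma ip_add_right: "f \<in> H \<Longrightarrow> g \<in> H \<Longrightarrow> h \<in> H \<Longrightarrow> ip h (f + g) = ip h f + ip h g"
  using ip_add_left ip_commute add_mem by metis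

lemma ip_diff_right: "f \<in> H \<Longrightarrow> g \<in> H \<Longrightarrow> h \<in> H \<Longrightarrow> ip h (f - g) = ip h f - ip h g"
  using ip_diff_left ip_commute diff_mem by metis

lemma ip_scale_right: "f \<in> H \<Longrightarrow> g \<in> H \<Longrightarrow> ip g (c *\<^sub>R f) = c * ip g f"
  using ip_scale_left ip_commute scale_mem by metis

lemmas ip_simps = ip_zero_left ip_zero_right ip_add_left ip_add_right ip_diff_left ip_diff_right
  ip_scale_left ip_scale_right mem

lemma nrm_nonneg: "f \<in> H \<Longrightarrow> 0 \<le> nrm f"
  by (simp add: fnorm_def ip_nonneg)

lemma nrm_power2: "f \<in> H \<Longrightarrow> (nrm f)\<^sup>2 = ip f f"
  by (simp add: fnorm_def ip_nonneg)

lemma nrm_eq_zero: "f \<in> H \<Longrightarrow> nrm f = 0 \<longleftrightarrow> f = 0"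
  using ip_eq_zeroD by (auto simp: fnorm_def ip_zero_left zero_mem)

lemma nrm_zero: "nrm 0 = 0"
  by (simp add: fnorm_def ip_zero_left zero_mem)

lemma nrm_scale: "f \<in> H \<Longrightarrow> nrm (c *\<^sub>R f) = \<bar>c\<bar> * nrm f"
  by (simp add: fnorm_def ip_simps real_sqrt_mult flip: mult.assoc)

lemma nrm_diff_commute: "f \<in> H \<Longrightarrow> g \<in> H \<Longrightarrow> nrm (f - g) = nrm (g - f)"
  by (simp add: fnorm_def ip_simps ip_commute)

lemma Cauchy_Schwarz:
  assumes f: "f \<in> H" and g: "g \<in> H"
  shows "\<bar>ip f g\<bar> \<le> nrm f * nrm g"
proof (cases "g = 0")
  case True
  then show ?thesis by (simp add: f ip_simps nrm_zero)
next
  case False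
  then have pos: "0 < ip g g"
    using ip_nonneg[OF g] ip_eq_zeroD[OF g] by linarith
  define t where "t = ip f g / ip g g"
  have "0 \<le> ip (f - t *\<^sub>R g) (f - t *\<^sub>R g)"
    by (intro ip_nonneg mem f g)
  also have "\<dots> = ip f f - (ip f g)\<^sup>2 / ip g g"
    using pos f g ip_commute[OF f g]
    by (simp add: ip_simps t_def field_simps power2_eq_square)
  finally have "(ip f g)\<^sup>2 \<le> (nrm f * nrm g)\<^sup>2"
    using pos f g by (simp add: field_simps nrm_power2)
  then show ?thesis
    using f g by (metis abs_le_square_iff abs_of_nonneg mult_nonneg_nonneg nrm_nonneg)
qed

lemma nrm_triangle:
  assumes f: "f \<in> H" and g: "g \<in> H"
  shows "nrm (f + g) \<le> nrm f + nrm g"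
proof (rule power2_le_imp_le)
  have "ip f g \<le> nrm f * nrm g"
    using Cauchy_Schwarz[OF f g] by linarith
  then show "(nrm (f + g))\<^sup>2 \<le> (nrm f + nrm g)\<^sup>2"
    using f g ip_commute[OF f g] by (simp add: nrm_power2 ip_simps power2_sum)
qed (simp add: f g nrm_nonneg)

lemma nrm_diff_triangle:
  assumes "f \<in> H" "g \<in> H" "h \<in> H"
  shows "nrm (f - h) \<le> nrm (f - g) + nrm (g - h)"
  using nrm_triangle[of "f - g" "g - h"] assms by (simp add: mem)

sublocale metric: Metric_space H "fdist H ip"
proof
  show "0 \<le> fdist H ip f g" for f g
    by (simp add: fdist_def nrm_nonneg mem)
  show "fdist H ip f g = fdist H ip g f" for f g
    by (auto simp: fdist_def nrm_diff_commute)
  show "fdist H ip f g = 0 \<longleftrightarrow> f = g" if "f \<in> H" "g \<in> H" for f g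
    using that by (simp add: fdist_def nrm_eq_zero mem)
  show "fdist H ip f h \<le> fdist H ip f g + fdist H ip g h" if "f \<in> H" "g \<in> H" "h \<in> H" for f g h
    using that by (simp add: fdist_def nrm_diff_triangle)
qed

lemma fdist_eq: "f \<in> H \<Longrightarrow> g \<in> H \<Longrightarrow> fdist H ip f g = nrm (f - g)"
  by (simp add: fdist_def)

section \<open>Orthogonal projection onto a finitely generated subspace\<close>

lemma orthogonal_to_span:
  assumes "B \<subseteq> H" "h \<in> H" "\<And>b. b \<in> B \<Longrightarrow> ip h b = 0" "s \<in> span B"
  shows "ip h s = 0"
proof -
  have "subspace {s \<in> H. ip h s = 0}"
    using assms(2) by (auto simp: subspace_def ip_simps)
  with assms show ?thesis
    using span_minimal[of B "{s \<in> H. ip h s = 0}"] by blast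
qed

text \<open>The induction performs one Gram--Schmidt step: the new generator \<open>a\<close> is replaced by its component
  orthogonal to the span of the others. This component vanishes if \<open>a\<close> depends on the others, so
  linearly dependent generators are covered.\<close>
lemma projection_exists:
  assumes "finite B" "B \<subseteq> H" "f \<in> H"
  shows "\<exists>s \<in> span B. \<forall>b \<in> B. ip (f - s) b = 0"
  using assms
proof (induction B arbitrary: f rule: finite_induct)
  case empty
  then show ?case by (simp add: span_zero)
next
  case (insert a B)
  then have aH: "a \<in> H" and BH: "B \<subseteq> H" by auto
  obtain p where p: "p \<in> span B" "\<forall>b \<in> B. ip (a - p) b = 0"
    using insert.IH[OF BH aH] by blast
  obtain q where q: "q \<in> span B" "\<forall>b \<in> B. ip (f - q) b = 0"
    using insert.IH[OF BH \<open>f \<in> H\<close>] by blast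
  have pH: "p \<in> H" and qH: "q \<in> H"
    using p q span_mem[OF BH] by auto
  define a' where "a' = a - p"
  define t where "t = ip (f - q) a' / ip a' a'"
  define s where "s = q + t *\<^sub>R a'"
  have a'H: "a' \<in> H" by (simp add: a'_def aH pH mem)
  have sH: "s \<in> H" by (simp add: s_def qH a'H mem)
  have orthB: "ip (f - s) b = 0" if "b \<in> B" for b
    using that p q BH insert.prems aH pH qH a'H
    by (auto simp: s_def ip_simps a'_def subset_iff)
  have ortha': "ip (f - s) a' = 0"
  proof (cases "ip a' a' = 0")
    case True
    then have "a' = 0" using ip_eq_zeroD a'H by blast
    then show ?thesis using sH insert.prems by (simp add: ip_simps)
  next
    case False
    then show ?thesis
      using insert.prems qH a'H by (simp add: s_def ip_simps t_def)
  qed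
  have "ip (f - s) p = 0"
    using orthogonal_to_span[OF BH _ orthB p(1)] sH insert.prems by (simp add: mem)
  then have "ip (f - s) a = 0"
    using ortha' sH pH aH insert.prems by (simp add: a'_def ip_simps)
  moreover have "s \<in> span (insert a B)"
    unfolding s_def a'_def using p(1) q(1) span_mono[of B "insert a B"]
    by (intro span_add span_scale span_diff span_base[of a]) auto
  ultimately show ?case using orthB by blast
qed

text \<open>Pythagoras: the error \<open>f - s\<close> is orthogonal to the difference \<open>s - t\<close> of the two candidates.\<close>
lemma projection_is_best_approximation:
  assumes B: "B \<subseteq> H" and f: "f \<in> H" and s: "s \<in> span B" and t: "t \<in> span B"
    and orth: "\<And>b. b \<in> B \<Longrightarrow> ip (f - s) b = 0"
  shows "nrm (f - s) \<le> nrm (f - t)"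
proof -
  have sH: "s \<in> H" and tH: "t \<in> H"
    using s t span_mem[OF B] by auto
  have "ip (f - s) (s - t) = 0"
    using orthogonal_to_span[OF B _ orth] s t f sH by (simp add: mem span_diff)
  then have "ip (f - t) (f - t) = ip (f - s) (f - s) + ip (s - t) (s - t)"
    using f sH tH by (simp add: ip_simps ip_commute)
  then show ?thesis
    using ip_nonneg[of "s - t"] sH tH by (simp add: fnorm_def mem)
qed

end

section \<open>The Riesz representation theorem\<close>

locale hilbert_function_space = inner_product_function_space +
  assumes complete: "metric.mcomplete"
begin

text \<open>The representer is obtained as the minimiser of the strictly convex functional
  \<open>J f = \<parallel>f\<parallel>\<^sup>2 - 2 \<phi> f\<close>. By the parallelogram law a minimising sequence is Cauchy, so completeness
  gives a minimiser \<open>g\<close>; the vanishing of the derivative of \<open>J\<close> at \<open>g\<close> in the direction \<open>f\<close> says that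
  \<open>\<phi> f = \<langle>f, g\<rangle>\<close>.\<close>
lemma riesz_bounded:
  assumes add: "\<And>f g. f \<in> H \<Longrightarrow> g \<in> H \<Longrightarrow> \<phi> (f + g) = \<phi> f + \<phi> g"
    and scale: "\<And>c f. f \<in> H \<Longrightarrow> \<phi> (c *\<^sub>R f) = c * \<phi> f"
    and bound: "\<And>f. f \<in> H \<Longrightarrow> \<bar>\<phi> f\<bar> \<le> C * nrm f"
  shows "\<exists>g \<in> H. \<forall>f \<in> H. \<phi> f = ip f g"
proof -
  define J where "J f = ip f f - 2 * \<phi> f" for f
  define m where "m = (INF f\<in>H. J f)"
  have J_ge: "- (C\<^sup>2) \<le> J f" if "f \<in> H" for f
  proof -
    have "0 \<le> (nrm f - C)\<^sup>2" by simp
    then have "2 * (C * nrm f) \<le> ip f f + C\<^sup>2"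
      using that by (simp add: power2_diff nrm_power2 mult.commute)
    then show ?thesis
      using bound[OF that] by (simp add: J_def abs_le_iff)
  qed
  have bdd: "bdd_below (J ` H)"
    using J_ge by (auto simp: bdd_below_def)
  have m_le: "m \<le> J f" if "f \<in> H" for f
    unfolding m_def using bdd that by (rule cINF_lower)
  have "\<exists>f \<in> H. J f < m + inverse (real (Suc n))" for n
    using cINF_less_iff[OF _ bdd, of "m + inverse (real (Suc n))"] zero_mem m_def by auto
  then obtain F where FH: "\<And>n. F n \<in> H" and FJ: "\<And>n. J (F n) < m + inverse (real (Suc n))"
    by metis
  have neg: "\<phi> (f - g) = \<phi> f - \<phi> g" if "f \<in> H" "g \<in> H" for f g
    using add[of "f - g" g] that by (simp add: mem)
  \<comment> \<open>The parallelogram law, in which the midpoint of \<open>f\<close> and \<open>g\<close> is estimated by the infimum \<open>m\<close>.\<close>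
  have close: "ip (f - g) (f - g) \<le> 2 * (J f - m) + 2 * (J g - m)" if "f \<in> H" "g \<in> H" for f g
  proof -
    have "m \<le> J ((1/2) *\<^sub>R (f + g))"
      using that by (intro m_le mem)
    then show ?thesis
      using that by (simp add: J_def ip_simps add scale ip_commute field_simps)
  qed
  have "metric.MCauchy F"
    unfolding metric.MCauchy_def
  proof (intro conjI allI impI)
    show "range F \<subseteq> H" using FH by auto
    fix e :: real assume e: "0 < e"
    then obtain N where N: "inverse (real (Suc N)) < e\<^sup>2 / 4"
      using reals_Archimedean[of "e\<^sup>2 / 4"] by auto
    show "\<exists>N. \<forall>n n'. N \<le> n \<longrightarrow> N \<le> n' \<longrightarrow> fdist H ip (F n) (F n') < e"
    proof (intro exI allI impI)
      fix n n' assume "N \<le> n" "N \<le> n'"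
      then have "inverse (real (Suc n)) \<le> inverse (real (Suc N))"
        "inverse (real (Suc n')) \<le> inverse (real (Suc N))"
        by (auto intro!: le_imp_inverse_le)
      then have "ip (F n - F n') (F n - F n') < e\<^sup>2"
        using close[OF FH FH, of n n'] FJ[of n] FJ[of n'] N by argo
      then show "fdist H ip (F n) (F n') < e"
        using e by (simp add: fdist_eq FH fnorm_def real_less_lsqrt)
    qed
  qed
  then obtain g where "limitin metric.mtopology F g sequentially"
    using complete unfolding metric.mcomplete_def by blast
  then have gH: "g \<in> H" and lim: "(\<lambda>n. nrm (F n - g)) \<longlonglongrightarrow> 0"
    by (auto simp: metric.limit_metric_sequentially fdist_eq FH LIMSEQ_iff nrm_nonneg mem)
  \<comment> \<open>Continuity of \<open>J\<close> at \<open>g\<close>, with an explicit modulus; in the limit it shows that \<open>g\<close> attains the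
    infimum.\<close>
  have "J g \<le> J (F n) + nrm (F n - g) * (2 * nrm g + 2 * C)" for n
  proof -
    have "J g = J (F n) - ip (F n - g) (F n - g) - 2 * ip (F n - g) g + 2 * \<phi> (F n - g)"
      using FH gH by (simp add: J_def ip_simps neg ip_commute algebra_simps)
    moreover have "- ip (F n - g) g \<le> nrm (F n - g) * nrm g"
      using Cauchy_Schwarz[of "F n - g" g] FH gH by (simp add: mem)
    moreover have "\<phi> (F n - g) \<le> C * nrm (F n - g)"
      using bound[of "F n - g"] FH gH by (simp add: mem)
    moreover have "0 \<le> ip (F n - g) (F n - g)"
      by (simp add: FH gH mem ip_nonneg)
    ultimately show ?thesis by (simp add: algebra_simps)
  qed
  then have "J g \<le> (m + inverse (real (Suc n))) + nrm (F n - g) * (2 * nrm g + 2 * C)" for n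
    using FJ[of n] by (smt (verit))
  moreover have "(\<lambda>n. (m + inverse (real (Suc n))) + nrm (F n - g) * (2 * nrm g + 2 * C))
      \<longlonglongrightarrow> (m + 0) + 0 * (2 * nrm g + 2 * C)"
    by (intro tendsto_intros lim LIMSEQ_inverse_real_of_nat)
  ultimately have "J g \<le> m"
    by (intro LIMSEQ_le_const) auto
  have "\<phi> f = ip f g" if f: "f \<in> H" for f
  proof (rule ccontr)
    assume "\<phi> f \<noteq> ip f g"
    define d where "d = \<phi> f - ip f g"
    \<comment> \<open>Comparison of \<open>J\<close> at \<open>g\<close> and at \<open>g + t f\<close>. A small \<open>t\<close> with the sign of \<open>d\<close> violates this bound;
      the denominator \<open>ip f f + 1\<close> chosen below also serves the case \<open>f = 0\<close>.\<close>
    have quad: "2 * t * d \<le> t\<^sup>2 * ip f f" for t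
    proof -
      have "J g \<le> J (g + t *\<^sub>R f)"
        using \<open>J g \<le> m\<close> m_le[of "g + t *\<^sub>R f"] f gH by (simp add: mem)
      then show ?thesis
        using f gH
        by (simp add: J_def d_def ip_simps add scale ip_commute algebra_simps power2_eq_square)
    qed
    have "d \<noteq> 0" using \<open>\<phi> f \<noteq> ip f g\<close> by (simp add: d_def)
    have pos: "0 < ip f f + 1" using ip_nonneg[OF f] by simp
    define t where "t = d / (ip f f + 1)"
    have d_eq: "d = t * (ip f f + 1)" and "t \<noteq> 0"
      using pos \<open>d \<noteq> 0\<close> by (auto simp: t_def)
    have "t\<^sup>2 * (ip f f + 2) \<le> 0"
      using quad[of t] unfolding d_eq by (simp add: algebra_simps power2_eq_square)
    moreover have "0 < t\<^sup>2 * (ip f f + 2)"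
      using \<open>t \<noteq> 0\<close> ip_nonneg[OF f] by (intro mult_pos_pos) auto
    ultimately show False by simp
  qed
  with gH show ?thesis by blast
qed

text \<open>Continuity is given topologically, so a ball on which the functional stays below \<open>1\<close> is extracted
  and every function is rescaled into it.\<close>
lemma dual_space_bounded:
  assumes "\<phi> \<in> dual_space H ip"
  shows "\<exists>C. \<forall>f \<in> H. \<bar>\<phi> f\<bar> \<le> C * nrm f"
proof -
  have scale: "\<phi> (c *\<^sub>R f) = c * \<phi> f" if "f \<in> H" for c f
    using assms that by (simp add: dual_space_def)
  have cont: "continuous_map metric.mtopology euclideanreal \<phi>"
    using assms by (simp add: dual_space_def ftopology_def)
  have "\<phi> 0 = 0" using scale[OF zero_mem, of 0] by simp
  have "openin metric.mtopology {f \<in> H. \<phi> f \<in> ball 0 1}"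
    using openin_continuous_map_preimage[OF cont, of "ball 0 1"] by simp
  moreover have "0 \<in> {f \<in> H. \<phi> f \<in> ball 0 1}"
    using \<open>\<phi> 0 = 0\<close> zero_mem by simp
  ultimately obtain r where r: "0 < r" "metric.mball 0 r \<subseteq> {f \<in> H. \<phi> f \<in> ball 0 1}"
    unfolding metric.openin_mtopology by blast
  have "\<bar>\<phi> f\<bar> \<le> (2 / r) * nrm f" if f: "f \<in> H" for f
  proof (cases "f = 0")
    case True
    then show ?thesis by (simp add: \<open>\<phi> 0 = 0\<close> nrm_zero)
  next
    case False
    then have pos: "0 < nrm f"
      using nrm_nonneg[OF f] nrm_eq_zero[OF f] by linarith
    define c where "c = r / (2 * nrm f)"
    have "nrm (0 - c *\<^sub>R f) = r / 2"
      using nrm_diff_commute[of "c *\<^sub>R f" 0] f pos r by (simp add: mem nrm_scale c_def)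
    then have "c *\<^sub>R f \<in> metric.mball 0 r"
      using r f by (simp add: fdist_eq mem)
    then have "\<bar>c * \<phi> f\<bar> < 1"
      using r(2) scale[OF f] by auto
    then show ?thesis
      using pos r(1) by (simp add: c_def field_simps abs_mult)
  qed
  then show ?thesis by blast
qed

lemma riesz:
  assumes "\<phi> \<in> dual_space H ip"
  shows "\<exists>g \<in> H. \<forall>f \<in> H. \<phi> f = ip f g"
proof -
  obtain C where "\<And>f. f \<in> H \<Longrightarrow> \<bar>\<phi> f\<bar> \<le> C * nrm f"
    using dual_space_bounded[OF assms] by blast
  then show ?thesis
    using assms by (intro riesz_bounded) (auto simp: dual_space_def)
qed

text \<open>Cauchy--Schwarz bounds the supremum, and the normalised representer attains it. The
  hypothesis concerns values on \<open>H\<close> instead of membership in the dual space, so that the lemma applies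
  to a pointwise difference of two functionals.\<close>
lemma dual_norm_represented:
  assumes g: "g \<in> H" and \<phi>: "\<And>f. f \<in> H \<Longrightarrow> \<phi> f = ip f g"
  shows "dual_norm H ip \<phi> = nrm g"
  unfolding dual_norm_def
proof (rule cSup_eq_maximum)
  show "nrm g \<in> (\<lambda>f. \<bar>\<phi> f\<bar>) ` {f \<in> H. nrm f \<le> 1}"
  proof (cases "g = 0")
    case True
    then show ?thesis
      using zero_mem by (intro image_eqI[of _ _ 0]) (auto simp: \<phi> ip_simps nrm_zero)
  next
    case False
    then have pos: "0 < nrm g"
      using nrm_nonneg[OF g] nrm_eq_zero[OF g] by linarith
    define u where "u = (1 / nrm g) *\<^sub>R g"
    have u: "u \<in> H" by (simp add: u_def g mem)
    have "\<phi> u = nrm g"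
      using pos g unfolding \<phi>[OF u]
      by (simp add: u_def ip_scale_left power2_eq_square flip: nrm_power2)
    moreover have "nrm u = 1"
      using pos g by (simp add: u_def nrm_scale)
    ultimately show ?thesis
      using u pos by (intro image_eqI[of _ _ u]) auto
  qed
next
  fix y assume "y \<in> (\<lambda>f. \<bar>\<phi> f\<bar>) ` {f \<in> H. nrm f \<le> 1}"
  then obtain f where f: "f \<in> H" "nrm f \<le> 1" and y: "y = \<bar>ip f g\<bar>"
    using \<phi> by auto
  have "y \<le> nrm f * nrm g" unfolding y by (rule Cauchy_Schwarz[OF f(1) g])
  also have "\<dots> \<le> 1 * nrm g" using f nrm_nonneg[OF g] by (intro mult_right_mono)
  finally show "y \<le> nrm g" by simp
qed

end

section \<open>Functionals on a reproducing kernel Hilbert space\<close>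

locale reproducing_kernel_space = hilbert_function_space +
  fixes K :: "'a \<Rightarrow> 'a \<Rightarrow> real"
  assumes kernel_commute: "K x y = K y x"
    and kernel_mem: "(\<lambda>y. K y x) \<in> H"
    and reproducing: "f \<in> H \<Longrightarrow> f x = ip f (\<lambda>y. K y x)"
begin

abbreviation "rep \<equiv> kernel_rep K"
abbreviation "Dual \<equiv> dual_space H ip"
abbreviation "ddist \<equiv> dual_dist H ip"

text \<open>If \<open>g\<close> is the Riesz representer of \<open>\<phi>\<close>, then \<open>\<phi>\<close> evaluated at the kernel section at \<open>x\<close> is the inner
  product of \<open>g\<close> with that section, which is \<open>g x\<close> by the reproducing property.\<close>
lemma kernel_rep_represents:
  assumes "\<phi> \<in> Dual"
  shows "rep \<phi> \<in> H" "f \<in> H \<Longrightarrow> \<phi> f = ip f (rep \<phi>)"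
proof -
  obtain g where g: "g \<in> H" "\<And>f. f \<in> H \<Longrightarrow> \<phi> f = ip f g"
    using riesz[OF assms] by blast
  have "rep \<phi> x = g x" for x
  proof -
    have "rep \<phi> x = \<phi> (\<lambda>y. K y x)"
      unfolding kernel_rep_def by (subst kernel_commute) simp
    also have "\<dots> = g x"
      using g kernel_mem[of x] by (simp add: reproducing ip_commute)
    finally show ?thesis .
  qed
  then have "rep \<phi> = g" by blast
  with g show "rep \<phi> \<in> H" "f \<in> H \<Longrightarrow> \<phi> f = ip f (rep \<phi>)" by auto
qed

lemma rep_image_subset: "\<Lambda> \<subseteq> Dual \<Longrightarrow> rep ` \<Lambda> \<subseteq> H"
  using kernel_rep_represents(1) by blast

lemma dual_dist_eq:
  assumes "\<phi> \<in> Dual" "\<psi> \<in> Dual"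
  shows "ddist \<phi> \<psi> = nrm (rep \<phi> - rep \<psi>)"
proof -
  have "dual_norm H ip (\<phi> - \<psi>) = nrm (rep \<phi> - rep \<psi>)"
    using assms kernel_rep_represents
    by (intro dual_norm_represented) (auto simp: mem ip_simps)
  with assms show ?thesis by (simp add: dual_dist_def)
qed

lemma rep_inj:
  assumes "\<phi> \<in> Dual" "\<psi> \<in> Dual" "rep \<phi> = rep \<psi>"
  shows "\<phi> = \<psi>"
proof (rule extensionalityI)
  show "\<phi> \<in> extensional H" "\<psi> \<in> extensional H"
    using assms by (auto simp: dual_space_def)
  show "\<phi> f = \<psi> f" if "f \<in> H" for f
    using kernel_rep_represents(2) assms that by metis
qed

sublocale dual: Metric_space Dual ddist
proof
  show "0 \<le> ddist \<phi> \<psi>" for \<phi> \<psi>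
    using dual_dist_eq kernel_rep_represents(1) nrm_nonneg mem(3)
    by (cases "\<phi> \<in> Dual \<and> \<psi> \<in> Dual") (auto simp: dual_dist_def)
  show "ddist \<phi> \<psi> = ddist \<psi> \<phi>" for \<phi> \<psi>
    using dual_dist_eq[of \<phi> \<psi>] dual_dist_eq[of \<psi> \<phi>] kernel_rep_represents(1) nrm_diff_commute
    by (cases "\<phi> \<in> Dual \<and> \<psi> \<in> Dual") (auto simp: dual_dist_def)
  show "ddist \<phi> \<psi> = 0 \<longleftrightarrow> \<phi> = \<psi>" if "\<phi> \<in> Dual" "\<psi> \<in> Dual" for \<phi> \<psi>
    using that kernel_rep_represents(1) rep_inj by (auto simp: dual_dist_eq nrm_eq_zero mem)
  show "ddist \<phi> \<xi> \<le> ddist \<phi> \<psi> + ddist \<psi> \<xi>"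
    if "\<phi> \<in> Dual" "\<psi> \<in> Dual" "\<xi> \<in> Dual" for \<phi> \<psi> \<xi>
    using that kernel_rep_represents(1) by (simp add: dual_dist_eq nrm_diff_triangle)
qed

text \<open>Since \<open>\<phi> (f - s) = \<langle>f - s, kernel_rep K \<phi>\<rangle>\<close>, the function \<open>s\<close> interpolates \<open>f\<close> exactly when the error
  \<open>f - s\<close> is orthogonal to the trial space. Existence and uniqueness of such an \<open>s\<close> make the definite
  description in the definition of the interpolant meaningful.\<close>
lemma interpolant_projection:
  assumes "finite \<Lambda>" "\<Lambda> \<subseteq> Dual" "f \<in> H"
  shows "interpolant K \<Lambda> f \<in> trial_space K \<Lambda>"
    and "\<phi> \<in> \<Lambda> \<Longrightarrow> ip (f - interpolant K \<Lambda> f) (rep \<phi>) = 0"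
proof -
  note B = rep_image_subset[OF assms(2)]
  have interp_iff: "(\<forall>\<phi>\<in>\<Lambda>. \<phi> s = \<phi> f) \<longleftrightarrow> (\<forall>b\<in>rep ` \<Lambda>. ip (f - s) b = 0)"
    if "s \<in> span (rep ` \<Lambda>)" for s
  proof -
    have sH: "s \<in> H" using span_mem[OF B that] .
    have "\<phi> s = \<phi> f \<longleftrightarrow> ip (f - s) (rep \<phi>) = 0" if "\<phi> \<in> \<Lambda>" for \<phi>
    proof -
      have "\<phi> \<in> Dual" using that assms(2) by blast
      then show ?thesis
        using kernel_rep_represents[of \<phi>] sH assms(3) by (auto simp: ip_simps)
    qed
    then show ?thesis by blast
  qed
  let ?P = "\<lambda>s. s \<in> trial_space K \<Lambda> \<and> (\<forall>\<phi>\<in>\<Lambda>. \<phi> s = \<phi> f)"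
  have P_iff: "?P s \<longleftrightarrow> s \<in> span (rep ` \<Lambda>) \<and> (\<forall>b\<in>rep ` \<Lambda>. ip (f - s) b = 0)" for s
    using interp_iff unfolding trial_space_def by blast
  obtain s where s: "?P s"
    using projection_exists[OF _ B assms(3)] assms(1) P_iff by blast
  have "s' = s" if s': "?P s'" for s'
  proof -
    have in_H: "s \<in> H" "s' \<in> H" and diff: "s' - s \<in> span (rep ` \<Lambda>)"
      using s s' P_iff span_mem[OF B] span_diff by auto
    have "ip (f - r) (s' - s) = 0" if r: "?P r" "r \<in> H" for r
      using r(1) r(2) assms(3) unfolding P_iff
      by (intro orthogonal_to_span[OF B _ _ diff]) (auto simp: diff_mem)
    then have "ip (f - s) (s' - s) = 0" "ip (f - s') (s' - s) = 0"
      using s s' in_H by auto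
    then have "ip (s' - s) (s' - s) = 0"
      using in_H assms(3) by (simp add: ip_simps)
    then show ?thesis
      using ip_eq_zeroD[of "s' - s"] in_H by (simp add: diff_mem)
  qed
  with s have "?P (interpolant K \<Lambda> f)"
    unfolding interpolant_def by (rule theI[where P = ?P])
  then show "interpolant K \<Lambda> f \<in> trial_space K \<Lambda>"
    and "\<phi> \<in> \<Lambda> \<Longrightarrow> ip (f - interpolant K \<Lambda> f) (rep \<phi>) = 0"
    using P_iff by auto
qed

lemma interpolant_best_approximation:
  assumes "finite \<Lambda>" "\<Lambda> \<subseteq> Dual" "f \<in> H" "t \<in> trial_space K \<Lambda>"
  shows "nrm (f - interpolant K \<Lambda> f) \<le> nrm (f - t)"
  using projection_is_best_approximation[OF rep_image_subset[OF assms(2)] assms(3)]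
    interpolant_projection[OF assms(1-3)] assms(4)
  unfolding trial_space_def by blast

lemma trial_space_subset: "\<Lambda> \<subseteq> Dual \<Longrightarrow> trial_space K \<Lambda> \<subseteq> H"
  unfolding trial_space_def using span_mem rep_image_subset by blast

section \<open>The fill distance of the greedy sets\<close>

lemma min_dist_attained:
  assumes "finite \<Lambda>" "\<Lambda> \<noteq> {}"
  shows "\<exists>\<mu>\<in>\<Lambda>. min_dist H ip \<gamma> \<Lambda> = ddist \<gamma> \<mu>"
  using Min_in[of "ddist \<gamma> ` \<Lambda>"] assms unfolding min_dist_def by blast

lemma min_dist_le:
  assumes "finite \<Lambda>" "\<mu> \<in> \<Lambda>"
  shows "min_dist H ip \<gamma> \<Lambda> \<le> ddist \<gamma> \<mu>"
  using assms unfolding min_dist_def by (intro Min_le) auto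

lemma min_dist_nonneg:
  assumes "finite \<Lambda>" "\<Lambda> \<noteq> {}"
  shows "0 \<le> min_dist H ip \<gamma> \<Lambda>"
  using min_dist_attained[OF assms] dual.nonneg by metis

text \<open>This makes the supremum in the fill distance, which is taken in the reals, a true supremum.\<close>
lemma min_dist_bdd_above:
  assumes "dual.mbounded \<Gamma>" "finite \<Lambda>" "\<Lambda> \<noteq> {}" "\<Lambda> \<subseteq> \<Gamma>"
  shows "bdd_above ((\<lambda>\<gamma>. min_dist H ip \<gamma> \<Lambda>) ` \<Gamma>)"
proof -
  obtain C where C: "\<And>x y. x \<in> \<Gamma> \<Longrightarrow> y \<in> \<Gamma> \<Longrightarrow> ddist x y \<le> C"
    using assms(1) unfolding dual.mbounded_alt by metis
  obtain \<mu> where \<mu>: "\<mu> \<in> \<Lambda>" using assms(3) by blast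
  have "min_dist H ip \<gamma> \<Lambda> \<le> C" if "\<gamma> \<in> \<Gamma>" for \<gamma>
    using min_dist_le[OF assms(2) \<mu>, of \<gamma>] C[OF that, of \<mu>] \<mu> assms(4) by auto
  then show ?thesis by (auto simp: bdd_above_def)
qed

lemma min_dist_le_fill_distance:
  assumes "dual.mbounded \<Gamma>" "finite \<Lambda>" "\<Lambda> \<noteq> {}" "\<Lambda> \<subseteq> \<Gamma>" "\<gamma> \<in> \<Gamma>"
  shows "min_dist H ip \<gamma> \<Lambda> \<le> fill_distance H ip \<Lambda> \<Gamma>"
  unfolding fill_distance_def using assms(5) min_dist_bdd_above[OF assms(1-4)]
  by (rule cSUP_upper)

lemma fill_distance_antimono:
  assumes "dual.mbounded \<Gamma>" "finite \<Lambda>'" "\<Lambda> \<noteq> {}" "\<Lambda> \<subseteq> \<Lambda>'" "\<Lambda>' \<subseteq> \<Gamma>"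
  shows "fill_distance H ip \<Lambda>' \<Gamma> \<le> fill_distance H ip \<Lambda> \<Gamma>"
  unfolding fill_distance_def
proof (rule cSUP_mono)
  show "\<Gamma> \<noteq> {}" using assms by blast
  show "bdd_above ((\<lambda>\<gamma>. min_dist H ip \<gamma> \<Lambda>) ` \<Gamma>)"
    using assms by (intro min_dist_bdd_above) (auto intro: finite_subset)
  show "\<exists>\<gamma>'\<in>\<Gamma>. min_dist H ip \<gamma> \<Lambda>' \<le> min_dist H ip \<gamma>' \<Lambda>" if "\<gamma> \<in> \<Gamma>" for \<gamma>
    using that assms unfolding min_dist_def
    by (intro bexI[of _ \<gamma>] Min_antimono) auto
qed

lemma greedy_sets:
  assumes "geometric_greedy H ip \<Gamma> l \<Lambda>" "1 \<le> n"
  shows "\<Lambda> n = l ` {1..n}" "\<Lambda> n \<subseteq> \<Gamma>"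
proof -
  have "\<Lambda> n = l ` {1..n} \<and> \<Lambda> n \<subseteq> \<Gamma>"
    using assms(2)
  proof (induction n rule: dec_induct)
    case base
    then show ?case using assms(1) by (simp add: geometric_greedy_def)
  next
    case (step n)
    then show ?case using assms(1) by (auto simp: geometric_greedy_def atLeastAtMostSuc_conv)
  qed
  then show "\<Lambda> n = l ` {1..n}" "\<Lambda> n \<subseteq> \<Gamma>" by auto
qed

text \<open>The key estimate is \<open>h_le\<close>: for \<open>1 \<le> m < n\<close> the functional \<open>l n\<close> was chosen at distance
  \<open>h (n - 1) \<ge> h n\<close> from the set \<open>\<Lambda> (n - 1)\<close>, which contains \<open>l m\<close>.\<close>
lemma fill_distance_greedy_tendsto_zero:
  assumes \<Gamma>: "dual.mtotally_bounded \<Gamma>" and greedy: "geometric_greedy H ip \<Gamma> l \<Lambda>"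
  shows "(\<lambda>n. fill_distance H ip (\<Lambda> n) \<Gamma>) \<longlonglongrightarrow> 0"
proof -
  define h where "h n = fill_distance H ip (\<Lambda> n) \<Gamma>" for n
  have bounded: "dual.mbounded \<Gamma>"
    using \<Gamma> by (rule dual.mtotally_bounded_imp_mbounded)
  have sets: "finite (\<Lambda> n)" "\<Lambda> n \<noteq> {}" "\<Lambda> n \<subseteq> \<Gamma>" if "1 \<le> n" for n
    using greedy_sets[OF greedy that] that by auto
  have l_mem: "l n \<in> \<Gamma>" if "1 \<le> n" for n
    using greedy_sets[OF greedy that] that by auto
  have h_mono: "h n \<le> h m" if "1 \<le> m" "m \<le> n" for m n
    unfolding h_def using that sets[of m] sets[of n]
      greedy_sets(1)[OF greedy, of m] greedy_sets(1)[OF greedy, of n]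
    by (intro fill_distance_antimono bounded) auto
  have h_nonneg: "0 \<le> h n" if "1 \<le> n" for n
    using min_dist_le_fill_distance[OF bounded sets[OF that] l_mem[of 1]]
      min_dist_nonneg[OF sets(1,2)[OF that], of "l 1"] by (simp add: h_def)
  have h_le: "h n \<le> ddist (l n) (l m)" if "1 \<le> m" "m < n" for m n
  proof -
    obtain k where k: "n = Suc k" "m \<le> k" using \<open>m < n\<close> by (cases n) auto
    have "1 \<le> k" using k that by simp
    have "h n \<le> h k" using \<open>1 \<le> k\<close> k by (intro h_mono) auto
    also have "h k = min_dist H ip (l n) (\<Lambda> k)"
      using greedy \<open>1 \<le> k\<close> k by (simp add: geometric_greedy_def h_def)
    also have "\<dots> \<le> ddist (l n) (l m)"
      using greedy_sets(1)[OF greedy \<open>1 \<le> k\<close>] that k by (intro min_dist_le sets \<open>1 \<le> k\<close>) auto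
    finally show ?thesis .
  qed
  \<comment> \<open>The sequence is shifted because \<open>l 0\<close> need not lie in \<open>\<Gamma>\<close>.\<close>
  have "range (\<lambda>n. l (Suc n)) \<subseteq> \<Gamma>"
    using l_mem by auto
  with \<Gamma> obtain r :: "nat \<Rightarrow> nat"
    where r: "strict_mono r" "dual.MCauchy ((\<lambda>n. l (Suc n)) \<circ> r)"
    unfolding dual.mtotally_bounded_sequentially by blast
  have "h \<longlonglongrightarrow> 0"
    unfolding LIMSEQ_iff
  proof (intro allI impI)
    fix e :: real assume "0 < e"
    then obtain N where "ddist (l (Suc (r (Suc N)))) (l (Suc (r N))) < e"
      using r(2) unfolding dual.MCauchy_def by (metis comp_apply le_Suc_eq order_refl)
    moreover have "h (Suc (r (Suc N))) \<le> ddist (l (Suc (r (Suc N)))) (l (Suc (r N)))"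
      using r(1) by (intro h_le) (auto simp: strict_mono_def)
    ultimately have "norm (h n - 0) < e" if "Suc (r (Suc N)) \<le> n" for n
      using h_mono[of "Suc (r (Suc N))" n] h_nonneg[of n] that by simp
    then show "\<exists>N. \<forall>n\<ge>N. norm (h n - 0) < e" by blast
  qed
  then show ?thesis by (simp add: h_def[abs_def])
qed

section \<open>Convergence of the interpolants\<close>

text \<open>The set \<open>A\<close> of functions for which the interpolation errors \<open>E\<close> tend to \<open>0\<close> is a closed subspace that
  contains the representers of \<open>\<Gamma>\<close>. All the error estimates come from \<open>E_le\<close>, the best approximation
  property, applied to a suitable element \<open>t\<close> of the trial space. The index \<open>0\<close> is left out of the
  hypotheses because the greedy rule says nothing about \<open>\<Lambda> 0\<close>.\<close>
lemma interpolant_tendsto_of_fill_distance: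
  assumes \<Gamma>: "\<Gamma> \<subseteq> Dual" "dual.mbounded \<Gamma>"
    and \<Lambda>: "\<And>n. 1 \<le> n \<Longrightarrow> finite (\<Lambda> n) \<and> \<Lambda> n \<noteq> {} \<and> \<Lambda> n \<subseteq> \<Gamma>"
    and fill: "(\<lambda>n. fill_distance H ip (\<Lambda> n) \<Gamma>) \<longlonglongrightarrow> 0"
    and f: "f \<in> native_subspace K H ip \<Gamma>"
  shows "(\<lambda>n. nrm (f - interpolant K (\<Lambda> n) f)) \<longlonglongrightarrow> 0"
proof -
  define E where "E f n = nrm (f - interpolant K (\<Lambda> n) f)" for f n
  define A where "A = {g \<in> H. E g \<longlonglongrightarrow> 0}"
  have \<Lambda>_Dual: "\<Lambda> n \<subseteq> Dual" if "1 \<le> n" for n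
    using \<Lambda>[OF that] \<Gamma> by blast
  have I_mem: "interpolant K (\<Lambda> n) g \<in> trial_space K (\<Lambda> n)" "interpolant K (\<Lambda> n) g \<in> H"
    if "1 \<le> n" "g \<in> H" for n g
    using interpolant_projection(1)[OF _ \<Lambda>_Dual[OF that(1)] that(2)] \<Lambda>[OF that(1)]
      trial_space_subset[OF \<Lambda>_Dual[OF that(1)]] by auto
  have E_nonneg: "0 \<le> E g n" if "1 \<le> n" "g \<in> H" for g n
    unfolding E_def using I_mem[OF that] that by (intro nrm_nonneg mem)
  have E_le: "E g n \<le> nrm (g - t)" if "1 \<le> n" "g \<in> H" "t \<in> trial_space K (\<Lambda> n)" for g n t
    unfolding E_def using that \<Lambda> \<Lambda>_Dual by (intro interpolant_best_approximation) auto
  have tendstoI: "E g \<longlonglongrightarrow> 0" if "g \<in> H" "b \<longlonglongrightarrow> 0" "\<And>n. 1 \<le> n \<Longrightarrow> E g n \<le> b n" for g b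
    using that E_nonneg
    by (intro Lim_null_comparison[OF eventually_sequentiallyI[of 1] \<open>b \<longlonglongrightarrow> 0\<close>]) auto
  \<comment> \<open>At the representer of \<open>\<gamma>\<close>, the candidate \<open>t\<close> is the representer of the nearest functional in \<open>\<Lambda> n\<close>.\<close>
  have "rep ` \<Gamma> \<subseteq> A"
  proof clarify
    fix \<gamma> assume \<gamma>: "\<gamma> \<in> \<Gamma>"
    then have \<gamma>D: "\<gamma> \<in> Dual" using \<Gamma> by blast
    have "E (rep \<gamma>) n \<le> fill_distance H ip (\<Lambda> n) \<Gamma>" if n: "1 \<le> n" for n
    proof -
      obtain \<mu> where \<mu>: "\<mu> \<in> \<Lambda> n" "min_dist H ip \<gamma> (\<Lambda> n) = ddist \<gamma> \<mu>"
        using min_dist_attained \<Lambda>[OF n] by blast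
      have "E (rep \<gamma>) n \<le> nrm (rep \<gamma> - rep \<mu>)"
        using \<mu>(1) n kernel_rep_represents(1)[OF \<gamma>D]
        by (intro E_le) (auto simp: trial_space_def intro: span_base)
      also have "\<dots> = min_dist H ip \<gamma> (\<Lambda> n)"
        using \<mu> \<gamma>D \<Lambda>_Dual[OF n] by (auto simp: dual_dist_eq)
      also have "\<dots> \<le> fill_distance H ip (\<Lambda> n) \<Gamma>"
        using \<Lambda>[OF n] \<gamma> by (intro min_dist_le_fill_distance \<Gamma>(2)) auto
      finally show ?thesis .
    qed
    then have "E (rep \<gamma>) \<longlonglongrightarrow> 0"
      using fill kernel_rep_represents(1)[OF \<gamma>D] by (intro tendstoI)
    then show "rep \<gamma> \<in> A"
      using kernel_rep_represents(1)[OF \<gamma>D] by (simp add: A_def)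
  qed
  moreover have "subspace A"
    unfolding subspace_def
  proof (intro conjI ballI allI)
    have "E 0 \<longlonglongrightarrow> 0"
    proof (rule tendstoI[OF zero_mem tendsto_const])
      show "E 0 n \<le> 0" if "1 \<le> n" for n
        using E_le[OF that zero_mem, of 0] by (simp add: trial_space_def span_zero nrm_zero)
    qed
    then show "0 \<in> A" by (simp add: A_def zero_mem)
  next
    fix f g assume "f \<in> A" "g \<in> A"
    then have H: "f \<in> H" "g \<in> H" and lim: "E f \<longlonglongrightarrow> 0" "E g \<longlonglongrightarrow> 0" by (auto simp: A_def)
    have "E (f + g) n \<le> E f n + E g n" if n: "1 \<le> n" for n
    proof -
      let ?If = "interpolant K (\<Lambda> n) f" and ?Ig = "interpolant K (\<Lambda> n) g"
      have "E (f + g) n \<le> nrm (f + g - (?If + ?Ig))"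
        using I_mem[OF n] H n by (intro E_le mem) (auto simp: trial_space_def span_add)
      also have "f + g - (?If + ?Ig) = (f - ?If) + (g - ?Ig)" by simp
      also have "nrm \<dots> \<le> E f n + E g n"
        unfolding E_def using I_mem[OF n] H by (intro nrm_triangle mem)
      finally show ?thesis .
    qed
    then have "E (f + g) \<longlonglongrightarrow> 0"
      using H by (intro tendstoI[OF _ tendsto_add_zero[OF lim]] mem)
    then show "f + g \<in> A" using H by (simp add: A_def mem)
  next
    fix c f assume "f \<in> A"
    then have H: "f \<in> H" and lim: "E f \<longlonglongrightarrow> 0" by (auto simp: A_def)
    have "E (c *\<^sub>R f) n \<le> \<bar>c\<bar> * E f n" if n: "1 \<le> n" for n
    proof -
      let ?If = "interpolant K (\<Lambda> n) f"
      have "E (c *\<^sub>R f) n \<le> nrm (c *\<^sub>R f - c *\<^sub>R ?If)"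
        using I_mem[OF n] H n by (intro E_le mem) (auto simp: trial_space_def span_scale)
      also have "c *\<^sub>R f - c *\<^sub>R ?If = c *\<^sub>R (f - ?If)" by (simp add: scaleR_diff_right)
      also have "nrm \<dots> = \<bar>c\<bar> * E f n"
        unfolding E_def using I_mem[OF n] H by (intro nrm_scale mem)
      finally show ?thesis .
    qed
    then have "E (c *\<^sub>R f) \<longlonglongrightarrow> 0"
      using H by (intro tendstoI[OF _ tendsto_mult_right_zero[OF lim]] mem)
    then show "c *\<^sub>R f \<in> A" using H by (simp add: A_def mem)
  qed
  ultimately have span_A: "span (rep ` \<Gamma>) \<subseteq> A" by (rule span_minimal)
  have fH: "f \<in> H"
    using f unfolding native_subspace_def ftopology_def metric.metric_closure_of by blast
  \<comment> \<open>Closedness of \<open>A\<close>: the candidate for \<open>f\<close> is the interpolant of a nearby \<open>g \<in> A\<close>.\<close>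
  have "E f \<longlonglongrightarrow> 0"
    unfolding LIMSEQ_iff
  proof (intro allI impI)
    fix e :: real assume "0 < e"
    then obtain g where g: "g \<in> A" and fg: "nrm (f - g) < e / 2"
      using f span_A unfolding native_subspace_def ftopology_def metric.metric_closure_of
      by (force simp: fdist_eq dest: spec[of _ "e / 2"])
    then have gH: "g \<in> H" and "E g \<longlonglongrightarrow> 0" by (auto simp: A_def)
    then obtain N where N: "\<And>n. N \<le> n \<Longrightarrow> norm (E g n - 0) < e / 2"
      using \<open>0 < e\<close> unfolding LIMSEQ_iff by (metis half_gt_zero)
    have "norm (E f n - 0) < e" if "max 1 N \<le> n" for n
    proof -
      have n: "1 \<le> n" "N \<le> n" using that by auto
      have "E f n \<le> nrm (f - interpolant K (\<Lambda> n) g)"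
        using n fH gH by (intro E_le I_mem)
      also have "\<dots> \<le> nrm (f - g) + E g n"
        unfolding E_def using n fH gH by (intro nrm_diff_triangle I_mem)
      finally show ?thesis
        using fg N[OF n(2)] E_nonneg[OF n(1) fH] by simp
    qed
    then show "\<exists>N. \<forall>n\<ge>N. norm (E f n - 0) < e" by blast
  qed
  then show ?thesis by (simp add: E_def[abs_def])
qed

end

section \<open>Convergence of the geometric greedy algorithm\<close>

theorem theorem4p5:
  fixes K :: "real ^ 'd \<Rightarrow> real ^ 'd \<Rightarrow> real"
    and H :: "(real ^ 'd \<Rightarrow> real) set"
    and ip :: "(real ^ 'd \<Rightarrow> real) \<Rightarrow> (real ^ 'd \<Rightarrow> real) \<Rightarrow> real"
    and \<Gamma> :: "((real ^ 'd \<Rightarrow> real) \<Rightarrow> real) set"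
    and l :: "nat \<Rightarrow> (real ^ 'd \<Rightarrow> real) \<Rightarrow> real"
    and \<Lambda> :: "nat \<Rightarrow> ((real ^ 'd \<Rightarrow> real) \<Rightarrow> real) set"
  assumes "positive_definite_kernel K"
    and "is_rkhs K H ip"
    and "\<Gamma> \<subseteq> dual_space H ip"
    and "dual_totally_bounded H ip \<Gamma>"
    and "geometric_greedy H ip \<Gamma> l \<Lambda>"
  shows "((\<lambda>n. fill_distance H ip (\<Lambda> n) \<Gamma>) \<longlonglongrightarrow> 0) \<and>
    (\<forall>f \<in> native_subspace K H ip \<Gamma>. (\<lambda>n. fnorm ip (f - interpolant K (\<Lambda> n) f)) \<longlonglongrightarrow> 0)"
proof -
  interpret reproducing_kernel_space H ip K
  proof (intro reproducing_kernel_space.intro hilbert_function_space.intro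
      inner_product_function_space.intro hilbert_function_space_axioms.intro
      reproducing_kernel_space_axioms.intro)
  qed (use assms(1,2) in \<open>auto simp: is_rkhs_def positive_definite_kernel_def\<close>)
  have tb: "dual.mtotally_bounded \<Gamma>"
    using assms(4) by (simp add: dual_totally_bounded_def)
  have fill: "(\<lambda>n. fill_distance H ip (\<Lambda> n) \<Gamma>) \<longlonglongrightarrow> 0"
    using tb assms(5) by (rule fill_distance_greedy_tendsto_zero)
  have sets: "finite (\<Lambda> n) \<and> \<Lambda> n \<noteq> {} \<and> \<Lambda> n \<subseteq> \<Gamma>" if "1 \<le> n" for n
    using greedy_sets[OF assms(5) that] that by auto
  show ?thesis
    using interpolant_tendsto_of_fill_distance[OF assms(3) dual.mtotally_bounded_imp_mbounded[OF tb]
        sets fill] fill by blast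
qed

end
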